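(* Let $R>0$, $\mu\in\mathbb{R}$, and let $f\in C_c^\infty(D_R)$. For $n\in\mathbb{Z}$ let $f_n$ and $g_n$ denote the angular Fourier coefficients of $f$ and of the attenuated V-line transform $\mathcal{V}_\mu f$, respectively. Then for every $n\in\mathbb{Z}$ and every $\psi\in(0,\pi/2)$, $$g_n(\psi)=2\,e^{-\mu R\cos(\psi)}\int_{R\sin(\psi)}^{R} f_n(r)\,\frac{r\,K_n(R\sin(\psi),r)}{\sqrt{r^2-R^2\sin(\psi)^2}}\,\mathrm{d}r,$$ where the kernel function is $$K_n(s,r):=\sum_{\sigma=\pm1}\sigma^n\,e^{\sigma\mu\sqrt{r^2-s^2}}\,\cos\Bigl(n\bigl(\arcsin(\tfrac{s}{r})-\sigma\arcsin(\tfrac{s}{R})\bigr)\Bigr).$$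
   Context: $D_R:=\{x\in\mathbb{R}^2 : \|x\|<R\}$ is the open disc of radius $R$, and $C_c^\infty(D_R)$ is the set of all smooth functions $f:\mathbb{R}^2\to\mathbb{R}$ with $\operatorname{supp}(f)\subseteq D_R$. For $\varphi\in\mathbb{R}$, $\Phi(\varphi):=(\cos\varphi,\sin\varphi)$. The attenuated V-line transform $\mathcal{V}_\mu f:[0,2\pi)\times(0,\pi/2)\to\mathbb{R}$ of $f\in C_c^\infty(D_R)$ with attenuation parameter $\mu\in\mathbb{R}$ is $$\mathcal{V}_\mu f(\varphi,\psi):=\sum_{\sigma=\pm1}\int_0^\infty f\bigl(R\,\Phi(\varphi)-r\,\Phi(\varphi-\sigma\psi)\bigr)\,e^{-\mu r}\,\mathrm{d}r.$$ The Fourier coefficients are (with $\mathsf{i}$ the imaginary unit) $$f_n(r):=\frac{1}{2\pi}\int_0^{2\pi}f(r\Phi(\varphi))\,e^{-\mathsf{i}n\varphi}\,\mathrm{d}\varphi,\qquad g_n(\psi):=\frac{1}{2\pi}\int_0^{2\pi}(\mathcal{V}_\mu f)(\varphi,\psi)\,e^{-\mathsf{i}n\varphi}\,\mathrm{d}\varphi.$$ *)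

theory Defs
  imports "HOL-Analysis.Analysis"
begin

text \<open>
  All integrals are Henstock--Kurzweil integrals, which extend the Lebesgue integral.
\<close>

definition disc :: "real \<Rightarrow> (real^2) set" where
  "disc R = {x. norm x < R}"

primrec Ck :: "nat \<Rightarrow> (real^2 \<Rightarrow> real) \<Rightarrow> bool" where
  "Ck 0 f \<longleftrightarrow> continuous_on UNIV f"
| "Ck (Suc k) f \<longleftrightarrow>
     (\<forall>x. f differentiable (at x)) \<and> (\<forall>v. Ck k (\<lambda>x. frechet_derivative f (at x) v))"

definition smooth :: "(real^2 \<Rightarrow> real) \<Rightarrow> bool" where
  "smooth f \<longleftrightarrow> (\<forall>k. Ck k f)"

text \<open>
  The constant \<^const>\<open>support_on\<close> is the set of points where a function is nonzero, without
  closure, so the closure is taken here. Compactness of the support follows, as a closed set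
  inside the bounded disc.
\<close>

definition Cc_infinity :: "real \<Rightarrow> (real^2 \<Rightarrow> real) set" where
  "Cc_infinity R = {f. smooth f \<and> closure (support_on UNIV f) \<subseteq> disc R}"

definition circ :: "real \<Rightarrow> real^2" where
  "circ \<phi> = vector [cos \<phi>, sin \<phi>]"

definition vline :: "real \<Rightarrow> real \<Rightarrow> (real^2 \<Rightarrow> real) \<Rightarrow> real \<Rightarrow> real \<Rightarrow> real" where
  "vline R \<mu> f \<phi> \<psi> =
     (\<Sum>\<sigma>\<in>{1, -1}. integral {0..}
        (\<lambda>r. f (R *\<^sub>R circ \<phi> - r *\<^sub>R circ (\<phi> - \<sigma> * \<psi>)) * exp (- \<mu> * r)))"

definition fourier_coeff :: "int \<Rightarrow> (real \<Rightarrow> real) \<Rightarrow> complex" where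
  "fourier_coeff n h =
     1 / (2 * of_real pi) *
       integral {0..2 * pi} (\<lambda>\<phi>. of_real (h \<phi>) * exp (- (\<i> * of_int n * of_real \<phi>)))"

definition f_coeff :: "(real^2 \<Rightarrow> real) \<Rightarrow> int \<Rightarrow> real \<Rightarrow> complex" where
  "f_coeff f n r = fourier_coeff n (\<lambda>\<phi>. f (r *\<^sub>R circ \<phi>))"

definition g_coeff :: "real \<Rightarrow> real \<Rightarrow> (real^2 \<Rightarrow> real) \<Rightarrow> int \<Rightarrow> real \<Rightarrow> complex" where
  "g_coeff R \<mu> f n \<psi> = fourier_coeff n (\<lambda>\<phi>. vline R \<mu> f \<phi> \<psi>)"

definition vline_kernel :: "real \<Rightarrow> real \<Rightarrow> int \<Rightarrow> real \<Rightarrow> real \<Rightarrow> real" where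
  "vline_kernel R \<mu> n s r =
     (\<Sum>\<sigma>\<in>{1, -1}. (\<sigma> powi n) * exp (\<sigma> * \<mu> * sqrt (r\<^sup>2 - s\<^sup>2)) *
        cos (of_int n * (arcsin (s / r) - \<sigma> * arcsin (s / R))))"

end

theory Submission
  imports Defs
begin

text \<open>
  Put $c = R \cos\psi$ and $s = R \sin\psi$. The line through $R\,\Phi(\varphi)$ with direction
  $\Phi(\varphi - \sigma\psi)$ comes closest to the origin at the ray parameter $r = c$, at distance
  $s$, and leaves the disc at $r = 2c$. Each ray therefore folds at $r = c$ into two halves
  $r = c - \kappa q$ with $\kappa = \pm 1$ and $0 \le q \le c$. On such a half the ray has the
  polar form
  \[ R\,\Phi(\varphi) - (c - \kappa q)\,\Phi(\varphi - \sigma\psi)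
     = \kappa\rho\;\Phi\bigl(\varphi + \sigma(\kappa\alpha - \psi)\bigr),
     \qquad \rho = \sqrt{q^2 + s^2},\quad \alpha = \arcsin(s/\rho), \]
  (\<open>ray_polar\<close>), in which $\varphi$ enters only through a rotation. Taking the $n$-th Fourier
  coefficient in $\varphi$ under the integral over $q$ thus turns $f$ into $f_n(\rho)$ times the
  phase $e^{\mathsf{i} n \sigma(\kappa\alpha - \psi)}$ (\<open>f_coeff_rotate\<close>) and the sign
  $\kappa^n$ caused by the negative radius $\kappa\rho$ (\<open>f_coeff_sign\<close>).

  The two phases $\sigma = \pm 1$ add up to $2\cos(n(\alpha - \kappa\psi))$, so the index of
  summation in the kernel $K_n$ is the half $\kappa$ of the ray and not the ray $\sigma$, and the
  attenuation $e^{-\mu(c - \kappa q)}$ supplies the remaining factors (\<open>g_coeff_polar\<close>).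
  Finally $q = \sqrt{r^2 - s^2}$ is substituted, whose derivative $r/\sqrt{r^2 - s^2}$ is the
  singular weight of the theorem. In the variable $q$ the integrand is continuous; the
  singularity at $r = s$ comes from the change of variables alone.
\<close>

section \<open>Fourier coefficients of rotated functions\<close>

text \<open>
  Both windows are compared with $[a, b + T]$: the pieces $[a, b]$ and $[a + T, b + T]$ by which
  they fall short of it are translates by the period. Windows may overlap or be disjoint.
\<close>

lemma integral_period_shift_le:
  fixes h :: "real \<Rightarrow> complex"
  assumes cont: "continuous_on UNIV h" and per: "\<And>x. h (x + T) = h x"
    and "0 \<le> T" "a \<le> b"
  shows "integral {a..a+T} h = integral {b..b+T} h"
proof -
  have int: "h integrable_on {u..v}" for u v
    using cont by (intro integrable_continuous_interval continuous_on_subset[OF cont]) auto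
  have "integral {a..a+T} h + integral {a+T..b+T} h = integral {a..b} h + integral {b..b+T} h"
    using Henstock_Kurzweil_Integration.integral_combine[of a "a+T" "b+T", OF _ _ int]
      Henstock_Kurzweil_Integration.integral_combine[of a b "b+T", OF _ _ int] assms(3,4)
    by simp
  moreover have "integral {a+T..b+T} h = integral {a..b} h"
    using integral_shift[OF continuous_on_subset[OF cont], of a T b] by (simp add: o_def per)
  ultimately show ?thesis by simp
qed

lemma integral_period_shift:
  fixes h :: "real \<Rightarrow> complex"
  assumes cont: "continuous_on UNIV h" and per: "\<And>x. h (x + T) = h x" and "0 \<le> T"
  shows "integral {0..T} (\<lambda>x. h (x + a)) = integral {0..T} h"
proof -
  have "integral {0..T} (\<lambda>x. h (x + a)) = integral {a..a+T} h"
    using integral_shift[OF continuous_on_subset[OF cont], of 0 a T]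
    by (simp add: o_def add.commute)
  also have "\<dots> = integral {0..0+T} h"
    using integral_period_shift_le[OF cont per \<open>0 \<le> T\<close>, of a 0]
      integral_period_shift_le[OF cont per \<open>0 \<le> T\<close>, of 0 a]
    by (cases "a \<le> 0") auto
  finally show ?thesis by simp
qed

lemma fourier_coeff_shift:
  fixes h :: "real \<Rightarrow> real"
  assumes cont: "continuous_on UNIV h" and per: "\<And>x. h (x + 2 * pi) = h x"
  shows "fourier_coeff n (\<lambda>\<phi>. h (\<phi> + a)) = cis (of_int n * a) * fourier_coeff n h"
proof -
  define e where "e = (\<lambda>\<phi>. of_real (h \<phi>) * exp (- (\<i> * of_int n * of_real \<phi>)))"
  have "exp (- (\<i> * of_int n * of_real (x + 2 * pi))) = exp (- (\<i> * of_int n * of_real x))" for x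
  proof -
    have "exp (- (\<i> * of_int n * of_real (x + 2 * pi))) =
        exp (- (\<i> * of_int n * of_real x)) * exp (of_int (2 * (- n)) * pi * \<i>)"
      by (simp add: exp_add[symmetric] algebra_simps)
    then show ?thesis
      using exp_integer_2pi[of "of_int (- n)"] by (simp add: mult_ac)
  qed
  then have eper: "e (x + 2 * pi) = e x" for x
    by (simp add: e_def per)
  have econt: "continuous_on UNIV e"
    unfolding e_def by (intro continuous_intros cont)
  have "of_real (h (\<phi> + a)) * exp (- (\<i> * of_int n * of_real \<phi>)) =
      cis (of_int n * a) * e (\<phi> + a)" for \<phi>
    by (simp add: e_def cis_conv_exp exp_add[symmetric] algebra_simps)
  then have "fourier_coeff n (\<lambda>\<phi>. h (\<phi> + a)) =
      1 / (2 * of_real pi) * integral {0..2 * pi} (\<lambda>\<phi>. cis (of_int n * a) * e (\<phi> + a))"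
    unfolding fourier_coeff_def by (simp only:)
  then show ?thesis
    using integral_period_shift[OF econt eper, of a]
    by (simp add: fourier_coeff_def e_def[symmetric])
qed

text \<open>Fubini's theorem for the rectangle $[0, 2\pi] \times [a, b]$.\<close>

lemma fourier_coeff_integral:
  fixes G :: "real \<Rightarrow> real \<Rightarrow> real"
  assumes cont: "continuous_on UNIV (\<lambda>(\<phi>, q). G \<phi> q)"
  shows "fourier_coeff n (\<lambda>\<phi>. integral {a..b} (G \<phi>)) =
      integral {a..b} (\<lambda>q. fourier_coeff n (\<lambda>\<phi>. G \<phi> q))"
proof -
  define E where "E = (\<lambda>\<phi>. exp (- (\<i> * of_int n * of_real \<phi>)))"
  have Gc: "continuous_on UNIV (G \<phi>)" for \<phi>
    using continuous_on_compose2[OF cont, of UNIV "\<lambda>q. (\<phi>, q)"] by (simp add: continuous_on_Pair)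
  have Gi: "G \<phi> integrable_on {a..b}" for \<phi>
    by (intro integrable_continuous_interval continuous_on_subset[OF Gc]) auto
  have cont': "continuous_on (cbox (0, a) (2 * pi, b))
      (\<lambda>(\<phi>, q). of_real (G \<phi> q) * E \<phi>)"
    using continuous_on_subset[OF cont]
    unfolding E_def split_beta by (intro continuous_intros) auto
  have "of_real (integral {a..b} (G \<phi>)) * E \<phi> = integral {a..b} (\<lambda>q. of_real (G \<phi> q) * E \<phi>)" for \<phi>
    using integral_linear[OF Gi[of \<phi>] bounded_linear_of_real[where 'a = complex]]
    by (simp add: o_def)
  then show ?thesis
    using integral_swap_continuous[OF cont']
    by (simp add: fourier_coeff_def E_def)
qed

lemma continuous_on_fourier_coeff:
  fixes G :: "real \<Rightarrow> real \<Rightarrow> real"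
  assumes cont: "continuous_on UNIV (\<lambda>(q, \<phi>). G q \<phi>)"
  shows "continuous_on UNIV (\<lambda>q. fourier_coeff n (G q))"
proof -
  have "continuous_on (UNIV \<times> cbox 0 (2 * pi))
      (\<lambda>(q, \<phi>). of_real (G q \<phi>) * exp (- (\<i> * of_int n * of_real \<phi>)))"
    using continuous_on_subset[OF cont]
    unfolding split_beta by (intro continuous_intros) auto
  from integral_continuous_on_param[OF this] show ?thesis
    unfolding fourier_coeff_def by (auto intro!: continuous_intros)
qed

lemma fourier_coeff_add:
  assumes "continuous_on UNIV g" "continuous_on UNIV h"
  shows "fourier_coeff n (\<lambda>\<phi>. g \<phi> + h \<phi>) = fourier_coeff n g + fourier_coeff n h"
proof -
  have "(\<lambda>\<phi>. of_real (g \<phi>) * exp (- (\<i> * of_int n * of_real \<phi>))) integrable_on {0..2*pi}"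
    if "continuous_on UNIV g" for g :: "real \<Rightarrow> real"
    using continuous_on_subset[OF that]
    by (intro integrable_continuous_interval continuous_intros) auto
  from integral_add[OF this[OF assms(1)] this[OF assms(2)]] show ?thesis
    by (simp add: fourier_coeff_def ring_distribs)
qed

lemma fourier_coeff_cmult:
  "fourier_coeff n (\<lambda>\<phi>. h \<phi> * c) = of_real c * fourier_coeff n h"
  by (simp add: fourier_coeff_def mult_ac)

section \<open>Circles and rays\<close>

lemma circ_nth [simp]: "circ \<phi> $ 1 = cos \<phi>" "circ \<phi> $ 2 = sin \<phi>"
  by (simp_all add: circ_def)

lemma continuous_on_circ [continuous_intros]:
  fixes g :: "'a::t2_space \<Rightarrow> real"
  assumes "continuous_on S g"
  shows "continuous_on S (\<lambda>x. circ (g x))"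
proof -
  have "(\<lambda>x. circ (g x)) = (\<lambda>x. \<chi> i. if i = 1 then cos (g x) else sin (g x))"
    by (auto simp: fun_eq_iff vec_eq_iff forall_2)
  moreover have "continuous_on S (\<lambda>x. if i = 1 then cos (g x) else sin (g x))" for i :: 2
    using continuous_on_cos[OF assms] continuous_on_sin[OF assms]
    by (cases "i = 1") simp_all
  ultimately show ?thesis
    by (simp only: continuous_on_vec_lambda)
qed

lemma continuous_on_circ_polar:
  fixes \<rho> \<theta> :: "'a::t2_space \<Rightarrow> real"
  assumes "continuous_on UNIV f" "continuous_on S \<rho>" "continuous_on S \<theta>"
  shows "continuous_on S (\<lambda>x. f (\<rho> x *\<^sub>R circ (\<theta> x)))"
  by (rule continuous_on_compose2[OF assms(1)]) (auto intro!: continuous_intros assms(2,3))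

lemma circ_plus_2pi: "circ (\<phi> + 2 * pi) = circ \<phi>"
  by (simp add: circ_def)

lemma norm_circ_diff:
  "(norm (R *\<^sub>R circ \<phi> - r *\<^sub>R circ (\<phi> - \<psi>)))\<^sup>2 = (r - R * cos \<psi>)\<^sup>2 + (R * sin \<psi>)\<^sup>2"
proof -
  have "(norm (R *\<^sub>R circ \<phi> - r *\<^sub>R circ (\<phi> - \<psi>)))\<^sup>2 =
     (R * cos \<phi> - r * cos (\<phi> - \<psi>))\<^sup>2 + (R * sin \<phi> - r * sin (\<phi> - \<psi>))\<^sup>2"
    by (simp add: power2_norm_eq_inner inner_vec_def sum_2 flip: power2_eq_square)
  also have "\<dots> = R\<^sup>2 * ((cos \<phi>)\<^sup>2 + (sin \<phi>)\<^sup>2) + r\<^sup>2 * ((cos (\<phi> - \<psi>))\<^sup>2 + (sin (\<phi> - \<psi>))\<^sup>2)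
      - 2 * R * r * cos (\<phi> - (\<phi> - \<psi>))"
    unfolding cos_diff[of \<phi> "\<phi> - \<psi>"] by algebra
  also have "\<dots> = R\<^sup>2 * ((cos \<psi>)\<^sup>2 + (sin \<psi>)\<^sup>2) + r\<^sup>2 - 2 * R * r * cos \<psi>"
    by simp
  also have "\<dots> = (r - R * cos \<psi>)\<^sup>2 + (R * sin \<psi>)\<^sup>2"
    by algebra
  finally show ?thesis .
qed

lemma f_coeff_rotate:
  assumes "continuous_on UNIV f"
  shows "fourier_coeff n (\<lambda>\<phi>. f (r *\<^sub>R circ (\<phi> + a))) = cis (of_int n * a) * f_coeff f n r"
  unfolding f_coeff_def
  by (rule fourier_coeff_shift[where h = "\<lambda>\<phi>. f (r *\<^sub>R circ \<phi>)"])
    (auto simp: circ_plus_2pi intro!: continuous_on_circ_polar assms continuous_intros)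

text \<open>
  A negative radius is a rotation by $\pi$, which contributes $e^{\mathsf{i} n \pi} = (-1)^n$.
  Allowing signed radii makes both halves of a ray instances of one formula.
\<close>

lemma f_coeff_sign:
  assumes "continuous_on UNIV f" and "\<kappa> \<in> {1, -1 :: real}"
  shows "f_coeff f n (\<kappa> * r) = of_real (\<kappa> powi n) * f_coeff f n r"
proof -
  have "- circ \<phi> = circ (\<phi> + pi)" for \<phi>
    by (simp add: vec_eq_iff forall_2)
  then have "f_coeff f n (- r) = fourier_coeff n (\<lambda>\<phi>. f (r *\<^sub>R circ (\<phi> + pi)))"
    unfolding f_coeff_def by (metis scaleR_minus_left scaleR_minus_right)
  also have "\<dots> = cis (of_int n * pi) * f_coeff f n r"
    by (rule f_coeff_rotate[OF assms(1)])
  also have "cis (of_int n * pi) = cis pi powi n"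
    by (simp only: cis_power_int)
  finally show ?thesis
    using assms(2) by auto
qed

lemma continuous_on_f_coeff:
  assumes "continuous_on UNIV f"
  shows "continuous_on UNIV (f_coeff f n)"
  unfolding f_coeff_def
  by (rule continuous_on_fourier_coeff[where G = "\<lambda>r \<phi>. f (r *\<^sub>R circ \<phi>)"])
    (auto simp: split_beta intro!: continuous_on_circ_polar assms continuous_intros)

text \<open>
  In the frame turned by $\varphi - \sigma\psi$, the starting point $R\,\Phi(\varphi)$ has the
  coordinates $(R\cos\psi, \sigma s)$, and moving along the ray changes only the first one. The
  point with parameter $R\cos\psi - \kappa q$ has the coordinates $(\kappa q, \sigma s)$, where
  $q = \rho\cos\alpha$ and $s = \rho\sin\alpha$; this is $\kappa\rho$ times the unit vector of
  angle $\sigma\kappa\alpha$.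
\<close>

lemma ray_polar:
  assumes "s > 0" "s = R * sin \<psi>" "\<kappa> \<in> {1, -1 :: real}" "\<sigma> \<in> {1, -1 :: real}" "q \<ge> 0"
  shows "R *\<^sub>R circ \<phi> - (R * cos \<psi> - \<kappa> * q) *\<^sub>R circ (\<phi> - \<sigma> * \<psi>) =
    (\<kappa> * sqrt (q\<^sup>2 + s\<^sup>2)) *\<^sub>R circ (\<phi> + \<sigma> * (\<kappa> * arcsin (s / sqrt (q\<^sup>2 + s\<^sup>2)) - \<psi>))"
proof -
  define \<rho> where "\<rho> = sqrt (q\<^sup>2 + s\<^sup>2)"
  define \<alpha> where "\<alpha> = arcsin (s / \<rho>)"
  have \<rho>: "\<rho> > 0" "\<rho>\<^sup>2 = q\<^sup>2 + s\<^sup>2"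
    using assms(1) by (auto simp: \<rho>_def add_nonneg_pos)
  have "s \<le> \<rho>"
    using \<rho> assms(1) by (intro power2_le_imp_le[of s \<rho>]) auto
  then have sin: "\<rho> * sin \<alpha> = s"
    using \<rho> assms(1) by (simp add: \<alpha>_def divide_le_eq le_divide_eq)
  have "1 - (s / \<rho>)\<^sup>2 = (q / \<rho>)\<^sup>2"
    using \<rho>(1) by (simp add: power_divide diff_eq_eq flip: add_divide_distrib \<rho>(2))
  then have cos: "\<rho> * cos \<alpha> = q"
    using \<rho> assms(1,5) \<open>s \<le> \<rho>\<close>
    by (simp add: \<alpha>_def cos_arcsin divide_le_eq le_divide_eq order.trans[of "-1" 0])
  \<comment> \<open>Both sides are expanded in the frame turned by $\varphi - \sigma\psi$.\<close>
  have c: "(\<kappa> * \<rho>) * cos (\<phi> - \<sigma> * \<psi> + \<sigma> * \<kappa> * \<alpha>) =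
     \<kappa> * q * cos (\<phi> - \<sigma> * \<psi>) - \<sigma> * s * sin (\<phi> - \<sigma> * \<psi>)"
    and d: "(\<kappa> * \<rho>) * sin (\<phi> - \<sigma> * \<psi> + \<sigma> * \<kappa> * \<alpha>) =
     \<kappa> * q * sin (\<phi> - \<sigma> * \<psi>) + \<sigma> * s * cos (\<phi> - \<sigma> * \<psi>)"
    using assms(3,4) unfolding sin[symmetric] cos[symmetric]
    by (auto simp: cos_add sin_add cos_diff sin_diff algebra_simps)
  have \<sigma>: "cos (\<sigma> * \<psi>) = cos \<psi>" "sin (\<sigma> * \<psi>) = \<sigma> * sin \<psi>"
    using assms(4) by auto
  have e: "R * cos \<phi> = R * cos \<psi> * cos (\<phi> - \<sigma> * \<psi>) - \<sigma> * s * sin (\<phi> - \<sigma> * \<psi>)"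
    "R * sin \<phi> = R * cos \<psi> * sin (\<phi> - \<sigma> * \<psi>) + \<sigma> * s * cos (\<phi> - \<sigma> * \<psi>)"
    using arg_cong[OF cos_add[of "\<phi> - \<sigma> * \<psi>" "\<sigma> * \<psi>"], of "(*) R"]
      arg_cong[OF sin_add[of "\<phi> - \<sigma> * \<psi>" "\<sigma> * \<psi>"], of "(*) R"]
    unfolding assms(2) \<sigma> by (simp_all only: diff_add_cancel) (simp_all add: algebra_simps)
  have "\<phi> + \<sigma> * (\<kappa> * \<alpha> - \<psi>) = \<phi> - \<sigma> * \<psi> + \<sigma> * \<kappa> * \<alpha>"
    by (simp add: algebra_simps)
  then show ?thesis
    unfolding \<rho>_def[symmetric] \<alpha>_def[symmetric]
    using c d e by (simp add: vec_eq_iff forall_2 algebra_simps)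
qed

section \<open>The V-line transform\<close>

lemma Cc_infinity_continuous:
  assumes "f \<in> Cc_infinity R"
  shows "continuous_on UNIV f"
  using assms Ck.simps(1) unfolding Cc_infinity_def smooth_def by blast

lemma Cc_infinity_eq_0:
  assumes "f \<in> Cc_infinity R" and "R \<le> norm x"
  shows "f x = 0"
proof (rule ccontr)
  assume "f x \<noteq> 0"
  then have "x \<in> closure (support_on UNIV f)"
    by (intro closure_subset[THEN subsetD]) (simp add: support_on_def)
  then show False
    using assms by (auto simp: Cc_infinity_def disc_def)
qed

text \<open>
  The chord that a ray cuts out of the disc is $[0, 2c]$; it is symmetric about its point $c$
  closest to the origin, and $\kappa$ selects one of its halves.
\<close>

lemma integral_fold_at_centre:
  fixes h :: "real \<Rightarrow> 'a::euclidean_space"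
  assumes cont: "continuous_on UNIV h" and "0 \<le> c"
    and zero: "\<And>r. 2 * c \<le> r \<Longrightarrow> h r = 0"
  shows "integral {0..} h = (\<Sum>\<kappa>\<in>{1, -1}. integral {0..c} (\<lambda>q. h (c - \<kappa> * q)))"
proof -
  have int: "h integrable_on {u..v}" for u v
    by (intro integrable_continuous_interval continuous_on_subset[OF cont]) auto
  have "integral {0..} h = integral {0..2 * c} h"
    by (rule integral_spike_set[symmetric]) (auto simp: zero intro: negligible_subset[of "{}"])
  also have "\<dots> = integral {0..c} h + integral {c..2 * c} h"
    using \<open>0 \<le> c\<close> by (simp add: Henstock_Kurzweil_Integration.integral_combine int)
  also have "integral {c..2 * c} h = integral {0..c} (\<lambda>q. h (c + q))"
    using integral_shift[OF continuous_on_subset[OF cont], of 0 c c] by (simp add: o_def add.commute)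
  also have "integral {0..c} h = integral {-c..0} (\<lambda>q. h (c + q))"
    using integral_shift[OF continuous_on_subset[OF cont], of "-c" c 0] by (simp add: o_def add.commute)
  also have "\<dots> = integral {0..c} (\<lambda>q. h (c - q))"
    using Henstock_Kurzweil_Integration.integral_reflect_real[of c 0 "\<lambda>q. h (c - q)"] by simp
  finally show ?thesis by simp
qed

text \<open>
  The parameter range ends at $2 R\cos\psi$ because the squared distance to the origin,
  $(r - R\cos\psi)^2 + (R\sin\psi)^2$, is at least $R^2$ from there on.
\<close>

lemma vline_polar:
  assumes "R > 0" and f: "f \<in> Cc_infinity R" and \<psi>: "\<psi> \<in> {0<..<pi/2}" and s: "s = R * sin \<psi>"
  shows "vline R \<mu> f \<phi> \<psi> =
    (\<Sum>\<sigma>\<in>{1, -1}. \<Sum>\<kappa>\<in>{1, -1}. integral {0..R * cos \<psi>} (\<lambda>q.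
       f ((\<kappa> * sqrt (q\<^sup>2 + s\<^sup>2)) *\<^sub>R
          circ (\<phi> + \<sigma> * (\<kappa> * arcsin (s / sqrt (q\<^sup>2 + s\<^sup>2)) - \<psi>))) *
       exp (- \<mu> * (R * cos \<psi> - \<kappa> * q))))"
proof -
  note fc = Cc_infinity_continuous[OF f]
  have "s > 0" "0 \<le> R * cos \<psi>"
    using \<open>R > 0\<close> \<psi> s by (auto intro!: sin_gt_zero mult_pos_pos mult_nonneg_nonneg cos_ge_zero)
  have "integral {0..} (\<lambda>r. f (R *\<^sub>R circ \<phi> - r *\<^sub>R circ (\<phi> - \<sigma> * \<psi>)) * exp (- \<mu> * r)) =
    (\<Sum>\<kappa>\<in>{1, -1}. integral {0..R * cos \<psi>} (\<lambda>q.
       f ((\<kappa> * sqrt (q\<^sup>2 + s\<^sup>2)) *\<^sub>R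
          circ (\<phi> + \<sigma> * (\<kappa> * arcsin (s / sqrt (q\<^sup>2 + s\<^sup>2)) - \<psi>))) *
       exp (- \<mu> * (R * cos \<psi> - \<kappa> * q))))" (is "integral _ ?h = _")
    if \<sigma>: "\<sigma> \<in> {1, -1}" for \<sigma>
  proof -
    have "?h r = 0" if "2 * (R * cos \<psi>) \<le> r" for r
    proof -
      have "cos (\<sigma> * \<psi>) = cos \<psi>" "(sin (\<sigma> * \<psi>))\<^sup>2 = (sin \<psi>)\<^sup>2"
        using \<sigma> by auto
      then have "(norm (R *\<^sub>R circ \<phi> - r *\<^sub>R circ (\<phi> - \<sigma> * \<psi>)))\<^sup>2 = 
          (r - R * cos \<psi>)\<^sup>2 + (R * sin \<psi>)\<^sup>2"
        by (simp add: norm_circ_diff power_mult_distrib)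
      also have "\<dots> \<ge> (R * cos \<psi>)\<^sup>2 + (R * sin \<psi>)\<^sup>2"
        using that \<open>0 \<le> R * cos \<psi>\<close> by (intro add_right_mono power_mono) auto
      also have "(R * cos \<psi>)\<^sup>2 + (R * sin \<psi>)\<^sup>2 = R\<^sup>2"
        by (simp add: power_mult_distrib flip: distrib_left)
      finally have "R \<le> norm (R *\<^sub>R circ \<phi> - r *\<^sub>R circ (\<phi> - \<sigma> * \<psi>))"
        by (rule power2_le_imp_le) simp
      from Cc_infinity_eq_0[OF f this] show ?thesis by simp
    qed
    moreover have "continuous_on UNIV ?h"
      by (intro continuous_intros continuous_on_compose2[OF fc]) auto
    ultimately have "integral {0..} ?h =
        (\<Sum>\<kappa>\<in>{1, -1}. integral {0..R * cos \<psi>} (\<lambda>q. ?h (R * cos \<psi> - \<kappa> * q)))"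
      using \<open>0 \<le> R * cos \<psi>\<close> by (intro integral_fold_at_centre) auto
    also have "\<dots> = (\<Sum>\<kappa>\<in>{1, -1}. integral {0..R * cos \<psi>} (\<lambda>q.
       f ((\<kappa> * sqrt (q\<^sup>2 + s\<^sup>2)) *\<^sub>R
          circ (\<phi> + \<sigma> * (\<kappa> * arcsin (s / sqrt (q\<^sup>2 + s\<^sup>2)) - \<psi>))) *
       exp (- \<mu> * (R * cos \<psi> - \<kappa> * q))))"
      using ray_polar[OF \<open>s > 0\<close> s _ \<sigma>]
      by (intro sum.cong refl integral_cong) auto
    finally show ?thesis .
  qed
  then show ?thesis
    unfolding vline_def by (intro sum.cong refl) auto
qed

text \<open>
  At $r = \sqrt{q^2 + s^2}$ the square root in the kernel is $q$, and $\arcsin(s/R) = \psi$. The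
  double sum over rays and halves collapses because $\sigma$ occurs only as the sign of a phase:
  $e^{\mathsf{i}nx} + e^{-\mathsf{i}nx} = 2\cos(nx)$ with $x = \kappa\alpha - \psi$, and
  $\cos(nx) = \cos(n(\alpha - \kappa\psi))$ for $\kappa = \pm 1$.
\<close>

lemma vline_kernel_polar:
  assumes "R > 0" "\<psi> \<in> {0<..<pi/2}" "s = R * sin \<psi>" "q \<ge> 0"
  shows "2 * of_real (vline_kernel R \<mu> n s (sqrt (q\<^sup>2 + s\<^sup>2))) =
    (\<Sum>\<sigma>\<in>{1, -1}. \<Sum>\<kappa>\<in>{1, -1}. of_real (\<kappa> powi n * exp (\<kappa> * \<mu> * q)) *
      cis (of_int n * (\<sigma> * (\<kappa> * arcsin (s / sqrt (q\<^sup>2 + s\<^sup>2)) - \<psi>))))"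
proof -
  define \<alpha> where "\<alpha> = arcsin (s / sqrt (q\<^sup>2 + s\<^sup>2))"
  have "arcsin (s / R) = \<psi>"
    using assms by (simp add: arcsin_sin)
  moreover have "sqrt ((sqrt (q\<^sup>2 + s\<^sup>2))\<^sup>2 - s\<^sup>2) = q"
    using assms(4) by simp
  ultimately have K: "vline_kernel R \<mu> n s (sqrt (q\<^sup>2 + s\<^sup>2)) =
    (\<Sum>\<kappa>\<in>{1, -1}. \<kappa> powi n * exp (\<kappa> * \<mu> * q) * cos (of_int n * (\<alpha> - \<kappa> * \<psi>)))"
    unfolding vline_kernel_def \<alpha>_def by simp
  have cos2: "cis (of_int n * x) + cis (of_int n * - x) = 2 * of_real (cos (of_int n * x))" for x
    by (simp add: complex_eq_iff)
  have cosm: "cos (of_int n * (- \<alpha> - \<psi>)) = cos (of_int n * (\<alpha> + \<psi>))"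
    using cos_minus[of "of_int n * (\<alpha> + \<psi>)"] by (simp add: algebra_simps)
  show ?thesis
    unfolding K unfolding \<alpha>_def[symmetric]
    using cos2[of "\<alpha> - \<psi>"] cos2[of "- \<alpha> - \<psi>"]
    unfolding cosm by (simp add: algebra_simps) algebra
qed

lemma continuous_on_arcsin_ratio:
  assumes "s > 0" "continuous_on S g"
  shows "continuous_on S (\<lambda>x. arcsin (s / sqrt ((g x)\<^sup>2 + s\<^sup>2)))"
proof -
  have pos: "sqrt ((g x)\<^sup>2 + s\<^sup>2) > 0" for x
    using assms(1) by (simp add: add_nonneg_pos)
  have "s \<le> sqrt ((g x)\<^sup>2 + s\<^sup>2)" for x
    by (rule real_le_rsqrt) simp
  then have "-1 \<le> s / sqrt ((g x)\<^sup>2 + s\<^sup>2) \<and> s / sqrt ((g x)\<^sup>2 + s\<^sup>2) \<le> 1" for x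
    using assms(1) pos[of x] by (auto simp: divide_le_eq le_divide_eq intro: order.trans[of _ 0])
  then show ?thesis
    using pos by (intro continuous_intros assms(2)) (auto simp: less_imp_neq[symmetric])
qed

text \<open>
  The formula of the theorem in the variable $q = \sqrt{r^2 - s^2}$, the distance along the ray
  from its point closest to the origin.
\<close>

lemma g_coeff_polar:
  assumes "R > 0" and f: "f \<in> Cc_infinity R" and \<psi>: "\<psi> \<in> {0<..<pi/2}" and s: "s = R * sin \<psi>"
  shows "g_coeff R \<mu> f n \<psi> = 2 * of_real (exp (- \<mu> * R * cos \<psi>)) *
    integral {0..R * cos \<psi>} (\<lambda>q. f_coeff f n (sqrt (q\<^sup>2 + s\<^sup>2)) *
      of_real (vline_kernel R \<mu> n s (sqrt (q\<^sup>2 + s\<^sup>2))))"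
proof -
  note fc = Cc_infinity_continuous[OF f]
  have "s > 0"
    using \<open>R > 0\<close> \<psi> s by (auto intro!: sin_gt_zero mult_pos_pos)
  define c where "c = R * cos \<psi>"
  define \<rho> where "\<rho> q = sqrt (q\<^sup>2 + s\<^sup>2)" for q
  define \<theta> where "\<theta> \<sigma> \<kappa> q = \<sigma> * (\<kappa> * arcsin (s / \<rho> q) - \<psi>)" for \<sigma> \<kappa> q
  define F where "F \<sigma> \<kappa> \<phi> q = f ((\<kappa> * \<rho> q) *\<^sub>R circ (\<phi> + \<theta> \<sigma> \<kappa> q)) * exp (- \<mu> * (c - \<kappa> * q))"
    for \<sigma> \<kappa> \<phi> q
  define H where "H \<sigma> \<kappa> q = of_real (exp (- \<mu> * c) * (\<kappa> powi n * exp (\<kappa> * \<mu> * q))) *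
      cis (of_int n * \<theta> \<sigma> \<kappa> q) * f_coeff f n (\<rho> q)" for \<sigma> \<kappa> q
  have \<theta>c: "continuous_on S (\<lambda>x. \<theta> \<sigma> \<kappa> (g x))" if "continuous_on S g" for \<sigma> \<kappa> g and S :: "'x::t2_space set"
    unfolding \<theta>_def \<rho>_def by (intro continuous_intros continuous_on_arcsin_ratio that \<open>s > 0\<close>)
  have \<rho>c: "continuous_on S (\<lambda>x. \<rho> (g x))" if "continuous_on S g" for g and S :: "'x::t2_space set"
    unfolding \<rho>_def by (intro continuous_intros that)
  have Fc: "continuous_on UNIV (\<lambda>(\<phi>, q). F \<sigma> \<kappa> \<phi> q)" for \<sigma> \<kappa>
    unfolding F_def split_beta
    by (intro continuous_intros continuous_on_circ_polar fc \<theta>c \<rho>c)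
  have Hi: "H \<sigma> \<kappa> integrable_on {0..c}" for \<sigma> \<kappa>
    unfolding H_def cis_conv_exp
    by (intro integrable_continuous_interval continuous_intros \<theta>c
        continuous_on_compose2[OF continuous_on_f_coeff[OF fc]] \<rho>c) auto
  have part: "fourier_coeff n (\<lambda>\<phi>. integral {0..c} (F \<sigma> \<kappa> \<phi>)) = integral {0..c} (H \<sigma> \<kappa>)"
    if \<kappa>: "\<kappa> \<in> {1, -1}" for \<sigma> \<kappa>
  proof -
    have "fourier_coeff n (\<lambda>\<phi>. F \<sigma> \<kappa> \<phi> q) = H \<sigma> \<kappa> q" for q
    proof -
      have "exp (- \<mu> * (c - \<kappa> * q)) = exp (- \<mu> * c) * exp (\<kappa> * \<mu> * q)"
        by (simp add: algebra_simps flip: exp_add)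
      then show ?thesis
        unfolding F_def H_def fourier_coeff_cmult f_coeff_rotate[OF fc] f_coeff_sign[OF fc \<kappa>]
        by (simp add: mult_ac)
    qed
    then show ?thesis
      by (simp add: fourier_coeff_integral[OF Fc])
  qed
  have Gc: "continuous_on UNIV (\<lambda>\<phi>. integral {0..c} (F \<sigma> \<kappa> \<phi>))" for \<sigma> \<kappa>
    using integral_continuous_on_param[of UNIV 0 c "F \<sigma> \<kappa>"] continuous_on_subset[OF Fc] by simp
  have "g_coeff R \<mu> f n \<psi> =
      fourier_coeff n (\<lambda>\<phi>. \<Sum>\<sigma>\<in>{1,-1}. \<Sum>\<kappa>\<in>{1,-1}. integral {0..c} (F \<sigma> \<kappa> \<phi>))"
    unfolding g_coeff_def vline_polar[OF assms] F_def \<theta>_def \<rho>_def c_def ..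
  also have "\<dots> = (\<Sum>\<sigma>\<in>{1,-1}. \<Sum>\<kappa>\<in>{1,-1}. integral {0..c} (H \<sigma> \<kappa>))"
    by (simp add: fourier_coeff_add Gc continuous_on_add part)
  also have "\<dots> = integral {0..c} (\<lambda>q. \<Sum>\<sigma>\<in>{1,-1}. \<Sum>\<kappa>\<in>{1,-1}. H \<sigma> \<kappa> q)"
    by (simp add: integral_add integrable_add Hi)
  also have "\<dots> = integral {0..c} (\<lambda>q. 2 * of_real (exp (- \<mu> * R * cos \<psi>)) *
      (f_coeff f n (\<rho> q) * of_real (vline_kernel R \<mu> n s (\<rho> q))))"
  proof (rule integral_cong)
    fix q assume "q \<in> {0..c}"
    then have "q \<ge> 0" by simp
    have "(\<Sum>\<sigma>\<in>{1,-1}. \<Sum>\<kappa>\<in>{1,-1}. H \<sigma> \<kappa> q) =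
        of_real (exp (- \<mu> * c)) * f_coeff f n (\<rho> q) *
        (2 * of_real (vline_kernel R \<mu> n s (\<rho> q)))"
      unfolding \<rho>_def vline_kernel_polar[OF \<open>R > 0\<close> \<psi> s \<open>q \<ge> 0\<close>]
      unfolding H_def \<theta>_def \<rho>_def of_real_mult sum_distrib_left by (simp only: mult_ac)
    then show "(\<Sum>\<sigma>\<in>{1,-1}. \<Sum>\<kappa>\<in>{1,-1}. H \<sigma> \<kappa> q) = 2 * of_real (exp (- \<mu> * R * cos \<psi>)) *
      (f_coeff f n (\<rho> q) * of_real (vline_kernel R \<mu> n s (\<rho> q)))"
      by (simp add: c_def mult_ac)
  qed
  finally show ?thesis
    by (simp add: \<rho>_def c_def)
qed

section \<open>The formula for the Fourier coefficients\<close>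

theorem theorem2p3:
  fixes R \<mu> :: real and f :: "real^2 \<Rightarrow> real" and n :: int and \<psi> :: real
  assumes "R > 0"
    and "f \<in> Cc_infinity R"
    and "\<psi> \<in> {0<..<pi/2}"
  shows "g_coeff R \<mu> f n \<psi> =
    2 * of_real (exp (- \<mu> * R * cos \<psi>)) *
      integral {R * sin \<psi>..R}
        (\<lambda>r. f_coeff f n r *
           of_real (r * vline_kernel R \<mu> n (R * sin \<psi>) r / sqrt (r\<^sup>2 - R\<^sup>2 * (sin \<psi>)\<^sup>2)))"
proof -
  note fc = Cc_infinity_continuous[OF assms(2)]
  define s where "s = R * sin \<psi>"
  define c where "c = R * cos \<psi>"
  define p where "p r = sqrt (r\<^sup>2 - s\<^sup>2)" for r
  define \<rho> where "\<rho> q = sqrt (q\<^sup>2 + s\<^sup>2)" for q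
  define H where "H q = f_coeff f n (\<rho> q) * of_real (vline_kernel R \<mu> n s (\<rho> q))" for q
  have "s > 0" "c \<ge> 0" "s \<le> R"
    using assms(1,3) by (auto simp: s_def c_def intro!: sin_gt_zero mult_pos_pos mult_nonneg_nonneg cos_ge_zero)
  have "R\<^sup>2 - s\<^sup>2 = c\<^sup>2"
    using sin_cos_squared_add[of \<psi>] unfolding s_def c_def by algebra
  then have p_ends: "p s = 0" "p R = c"
    using \<open>c \<ge> 0\<close> by (auto simp: p_def)
  have \<rho>p: "\<rho> (p r) = r" if "r \<ge> s" for r
  proof -
    have "s\<^sup>2 \<le> r\<^sup>2"
      using that \<open>s > 0\<close> by (intro power_mono) auto
    then show ?thesis
      using that \<open>s > 0\<close> by (simp add: \<rho>_def p_def)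
  qed
  have "continuous_on {0..c} H"
  proof -
    have pq: "sqrt ((\<rho> q)\<^sup>2 - s\<^sup>2) = \<bar>q\<bar>" for q
      by (simp add: \<rho>_def)
    have "continuous_on {0..c} (\<lambda>q. vline_kernel R \<mu> n s (\<rho> q))"
      unfolding vline_kernel_def pq unfolding \<rho>_def
      by (intro continuous_intros continuous_on_arcsin_ratio \<open>s > 0\<close>)
    then show ?thesis
      unfolding H_def \<rho>_def
      by (intro continuous_intros continuous_on_compose2[OF continuous_on_f_coeff[OF fc]]) auto
  qed
  moreover have "p ` {s..R} \<subseteq> {0..c}"
    using \<open>s > 0\<close> unfolding p_ends(2)[symmetric] p_def by (auto intro!: power_mono)
  moreover have "continuous_on {s..R} p"
    unfolding p_def by (intro continuous_intros)
  moreover have "(p has_field_derivative r / p r) (at r within {s..R})" if "r \<in> {s..R} - {s}" for r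
  proof -
    have "s\<^sup>2 < r\<^sup>2"
      using that \<open>s > 0\<close> by (intro power_strict_mono) auto
    then show ?thesis
      unfolding p_def by (auto intro!: derivative_eq_intros simp: field_simps)
  qed
  \<comment> \<open>The exceptional point $s$, where the derivative of $p$ blows up, is admitted by this form of
    the substitution rule because $p$ and $H$ are continuous there.\<close>
  ultimately have "((\<lambda>r. (r / p r) *\<^sub>R H (p r)) has_integral
      integral {p s..p R} H - integral {p R..p s} H) {s..R}"
    using \<open>s \<le> R\<close> by (intro has_integral_substitution_general[where s = "{s}" and c = 0 and d = c]) auto
  moreover have "integral {c..0} H = 0"
    using \<open>c \<ge> 0\<close> by (cases "c = 0") auto
  ultimately have "((\<lambda>r. (r / p r) *\<^sub>R H (p r)) has_integral integral {0..c} H) {s..R}"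
    by (simp add: p_ends)
  then have "integral {0..c} H = integral {s..R} (\<lambda>r. (r / p r) *\<^sub>R H (p r))"
    by (simp add: integral_unique)
  also have "\<dots> = integral {s..R} (\<lambda>r. f_coeff f n r * of_real (r * vline_kernel R \<mu> n s r / p r))"
    by (intro integral_cong) (auto simp: H_def \<rho>p scaleR_conv_of_real)
  finally show ?thesis
    using g_coeff_polar[OF assms s_def, of \<mu> n]
    unfolding H_def \<rho>_def s_def c_def p_def by (simp add: power_mult_distrib)
qed

end
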